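(* There is no lattice embedding from $B_\omega$ into $H_n$ for any $n$, and there is no lattice embedding from $B_\omega$ into $H_\omega$.
   Context: $B_\omega$ is the countable atomless Boolean algebra, i.e. the Lindenbaum algebra of classical propositional logic on countably infinitely many variables (the free Boolean algebra on countably infinitely many generators). $H_n$ (respectively $H_\omega$) is the free Heyting algebra on $n$ (respectively countably infinitely many) generators, i.e. propositional formulas in $n$ (respectively countably infinitely many) variables modulo intuitionistic logical equivalence. A lattice embedding is an injective map preserving $\wedge$ and $\vee$; it is not required to preserve $\top$ or $\bot$. *)

theory Defs
  imports "HOL-Algebra.Lattice"
begin

datatype form =
    Var nat
  | Falsum
  | Conj form form
  | Disj form form
  | Impl form form

abbreviation Neg :: "form \<Rightarrow> form" where
  "Neg p \<equiv> Impl p Falsum"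

primrec vars :: "form \<Rightarrow> nat set" where
  "vars (Var x) = {x}"
| "vars Falsum = {}"
| "vars (Conj p q) = vars p \<union> vars q"
| "vars (Disj p q) = vars p \<union> vars q"
| "vars (Impl p q) = vars p \<union> vars q"

definition forms :: "nat set \<Rightarrow> form set" where
  "forms V = {p. vars p \<subseteq> V}"

inductive derives :: "form set \<Rightarrow> form \<Rightarrow> bool" (infix \<open>\<turnstile>\<close> 50) where
  Assm: "p \<in> \<Gamma> \<Longrightarrow> \<Gamma> \<turnstile> p"
| FalsumE: "\<Gamma> \<turnstile> Falsum \<Longrightarrow> \<Gamma> \<turnstile> p"
| ConjI: "\<Gamma> \<turnstile> p \<Longrightarrow> \<Gamma> \<turnstile> q \<Longrightarrow> \<Gamma> \<turnstile> Conj p q"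
| ConjE1: "\<Gamma> \<turnstile> Conj p q \<Longrightarrow> \<Gamma> \<turnstile> p"
| ConjE2: "\<Gamma> \<turnstile> Conj p q \<Longrightarrow> \<Gamma> \<turnstile> q"
| DisjI1: "\<Gamma> \<turnstile> p \<Longrightarrow> \<Gamma> \<turnstile> Disj p q"
| DisjI2: "\<Gamma> \<turnstile> q \<Longrightarrow> \<Gamma> \<turnstile> Disj p q"
| DisjE: "\<Gamma> \<turnstile> Disj p q \<Longrightarrow> insert p \<Gamma> \<turnstile> r \<Longrightarrow> insert q \<Gamma> \<turnstile> r \<Longrightarrow> \<Gamma> \<turnstile> r"
| ImplI: "insert p \<Gamma> \<turnstile> q \<Longrightarrow> \<Gamma> \<turnstile> Impl p q"
| ImplE: "\<Gamma> \<turnstile> Impl p q \<Longrightarrow> \<Gamma> \<turnstile> p \<Longrightarrow> \<Gamma> \<turnstile> q"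

lemma derives_mono: "\<Gamma> \<turnstile> p \<Longrightarrow> \<Gamma> \<subseteq> \<Delta> \<Longrightarrow> \<Delta> \<turnstile> p"
proof (induction arbitrary: \<Delta> rule: derives.induct)
  case (Assm p \<Gamma>)
  then show ?case by (blast intro: derives.Assm)
next
  case (FalsumE \<Gamma> p)
  then show ?case by (meson derives.FalsumE)
next
  case (ConjI \<Gamma> p q)
  then show ?case by (meson derives.ConjI)
next
  case (ConjE1 \<Gamma> p q)
  then show ?case by (meson derives.ConjE1)
next
  case (ConjE2 \<Gamma> p q)
  then show ?case by (meson derives.ConjE2)
next
  case (DisjI1 \<Gamma> p q)
  then show ?case by (meson derives.DisjI1)
next
  case (DisjI2 \<Gamma> q p)
  then show ?case by (meson derives.DisjI2)
next
  case (DisjE \<Gamma> p q r)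
  then show ?case by (meson derives.DisjE insert_mono)
next
  case (ImplI p \<Gamma> q)
  then show ?case by (meson derives.ImplI insert_mono)
next
  case (ImplE \<Gamma> p q)
  then show ?case by (meson derives.ImplE)
qed

lemma derives_cut:
  assumes "insert p \<Gamma> \<turnstile> q" "insert q \<Gamma> \<turnstile> r"
  shows "insert p \<Gamma> \<turnstile> r"
proof -
  have "insert p \<Gamma> \<turnstile> Impl q r"
    using assms(2) by (intro ImplI) (auto elim: derives_mono)
  then show ?thesis using assms(1) by (rule ImplE)
qed

text \<open>Classical derivability is intuitionistic derivability from all instances
  of excluded middle.\<close>

definition excluded_middle :: "form set" where
  "excluded_middle = range (\<lambda>p. Disj p (Neg p))"

text \<open>\<^term>\<open>lindenbaum T V\<close> consists of the formulas with variables in \<^term>\<open>V\<close>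
  modulo provable equivalence over \<^term>\<open>T\<close>, ordered by provable implication.
  The order is stated through representatives; \<open>lindenbaum_le\<close> below shows that it does
  not depend on their choice.\<close>

definition lindenbaum_rel :: "form set \<Rightarrow> nat set \<Rightarrow> (form \<times> form) set" where
  "lindenbaum_rel T V =
     {(p, q). p \<in> forms V \<and> q \<in> forms V \<and> insert p T \<turnstile> q \<and> insert q T \<turnstile> p}"

definition lindenbaum :: "form set \<Rightarrow> nat set \<Rightarrow> form set gorder" where
  "lindenbaum T V =
     \<lparr> carrier = forms V // lindenbaum_rel T V,
       eq = (=),
       le = (\<lambda>X Y. \<exists>p\<in>X. \<exists>q\<in>Y. insert p T \<turnstile> q) \<rparr>"

definition B_omega :: "form set gorder" where
  "B_omega = lindenbaum excluded_middle UNIV"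

text \<open>Derivations between formulas in the first \<open>n\<close> variables may pass through other
  variables. This identifies no further formulas: substituting \<^const>\<open>Falsum\<close> for the
  other variables preserves derivations.\<close>

definition H_fin :: "nat \<Rightarrow> form set gorder" where
  "H_fin n = lindenbaum {} {..<n}"

definition H_omega :: "form set gorder" where
  "H_omega = lindenbaum {} UNIV"

lemma equiv_lindenbaum_rel: "equiv (forms V) (lindenbaum_rel T V)"
proof (rule equivI)
  show "lindenbaum_rel T V \<subseteq> forms V \<times> forms V"
    by (auto simp: lindenbaum_rel_def)
  show "refl_on (forms V) (lindenbaum_rel T V)"
    by (auto simp: lindenbaum_rel_def refl_on_def Assm)
  show "sym (lindenbaum_rel T V)"
    by (auto simp: lindenbaum_rel_def sym_def)
  show "trans (lindenbaum_rel T V)"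
    unfolding lindenbaum_rel_def trans_def by (blast intro: derives_cut)
qed

lemma lindenbaum_class_mem: "p \<in> forms V \<Longrightarrow> p \<in> lindenbaum_rel T V `` {p}"
  by (rule equiv_class_self[OF equiv_lindenbaum_rel])

lemma lindenbaum_carrierI:
  "p \<in> forms V \<Longrightarrow> lindenbaum_rel T V `` {p} \<in> carrier (lindenbaum T V)"
  by (simp add: lindenbaum_def quotientI)

lemma lindenbaum_carrierE:
  assumes "X \<in> carrier (lindenbaum T V)"
  obtains p where "p \<in> forms V" "X = lindenbaum_rel T V `` {p}"
  using assms by (auto simp: lindenbaum_def elim: quotientE)

lemma lindenbaum_le:
  assumes "p \<in> forms V" "q \<in> forms V"
  shows "lindenbaum_rel T V `` {p} \<sqsubseteq>\<^bsub>lindenbaum T V\<^esub> lindenbaum_rel T V `` {q}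
    \<longleftrightarrow> insert p T \<turnstile> q"
proof
  assume "lindenbaum_rel T V `` {p} \<sqsubseteq>\<^bsub>lindenbaum T V\<^esub> lindenbaum_rel T V `` {q}"
  then obtain p' q' where "insert p T \<turnstile> p'" "insert p' T \<turnstile> q'" "insert q' T \<turnstile> q"
    by (auto simp: lindenbaum_def lindenbaum_rel_def)
  then show "insert p T \<turnstile> q" by (meson derives_cut)
next
  assume "insert p T \<turnstile> q"
  then show "lindenbaum_rel T V `` {p} \<sqsubseteq>\<^bsub>lindenbaum T V\<^esub> lindenbaum_rel T V `` {q}"
    using assms[THEN lindenbaum_class_mem] unfolding lindenbaum_def gorder.simps by blast
qed

lemma lindenbaum_class_eq_iff:
  assumes "p \<in> forms V" "q \<in> forms V"
  shows "lindenbaum_rel T V `` {p} = lindenbaum_rel T V `` {q}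
    \<longleftrightarrow> insert p T \<turnstile> q \<and> insert q T \<turnstile> p"
  using assms eq_equiv_class_iff[OF equiv_lindenbaum_rel, of p V q T]
  by (auto simp: lindenbaum_rel_def)

lemma lindenbaum_le_antisym:
  assumes "X \<sqsubseteq>\<^bsub>lindenbaum T V\<^esub> Y" "Y \<sqsubseteq>\<^bsub>lindenbaum T V\<^esub> X"
    "X \<in> carrier (lindenbaum T V)" "Y \<in> carrier (lindenbaum T V)"
  shows "X = Y"
proof -
  obtain p where p: "p \<in> forms V" "X = lindenbaum_rel T V `` {p}"
    using assms(3) by (rule lindenbaum_carrierE)
  obtain q where q: "q \<in> forms V" "Y = lindenbaum_rel T V `` {q}"
    using assms(4) by (rule lindenbaum_carrierE)
  show ?thesis
    using assms(1,2) p(1) q(1) unfolding p(2) q(2)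
    by (simp only: lindenbaum_le lindenbaum_class_eq_iff)
qed

lemma lindenbaum_le_trans:
  assumes "X \<sqsubseteq>\<^bsub>lindenbaum T V\<^esub> Y" "Y \<sqsubseteq>\<^bsub>lindenbaum T V\<^esub> Z"
    "X \<in> carrier (lindenbaum T V)" "Y \<in> carrier (lindenbaum T V)" "Z \<in> carrier (lindenbaum T V)"
  shows "X \<sqsubseteq>\<^bsub>lindenbaum T V\<^esub> Z"
proof -
  obtain p where p: "p \<in> forms V" "X = lindenbaum_rel T V `` {p}"
    using assms(3) by (rule lindenbaum_carrierE)
  obtain q where q: "q \<in> forms V" "Y = lindenbaum_rel T V `` {q}"
    using assms(4) by (rule lindenbaum_carrierE)
  obtain r where r: "r \<in> forms V" "Z = lindenbaum_rel T V `` {r}"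
    using assms(5) by (rule lindenbaum_carrierE)
  have "insert p T \<turnstile> q" "insert q T \<turnstile> r"
    using assms(1,2) unfolding p(2) q(2) r(2) lindenbaum_le[OF p(1) q(1)] lindenbaum_le[OF q(1) r(1)] .
  then have "insert p T \<turnstile> r" by (rule derives_cut)
  then show ?thesis
    unfolding p(2) r(2) lindenbaum_le[OF p(1) r(1)] .
qed

lemma lindenbaum_le_refl:
  assumes "X \<in> carrier (lindenbaum T V)"
  shows "X \<sqsubseteq>\<^bsub>lindenbaum T V\<^esub> X"
proof -
  obtain p where p: "p \<in> forms V" "X = lindenbaum_rel T V `` {p}"
    using assms by (rule lindenbaum_carrierE)
  show ?thesis
    unfolding p(2) lindenbaum_le[OF p(1) p(1)] by (rule Assm) simp
qed

lemma lindenbaum_eq: "(.=\<^bsub>lindenbaum T V\<^esub>) = (=)"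
  by (simp add: lindenbaum_def)

lemma partial_order_lindenbaum: "partial_order (lindenbaum T V)"
  by unfold_locales
    ((simp add: lindenbaum_eq lindenbaum_le_refl; fail)
      | (unfold lindenbaum_eq, erule lindenbaum_le_antisym; assumption)
      | (erule lindenbaum_le_trans; assumption))+

lemma greatest_lindenbaum:
  assumes "p \<in> forms V" "q \<in> forms V"
  shows "greatest (lindenbaum T V) (lindenbaum_rel T V `` {Conj p q})
    (Lower (lindenbaum T V) {lindenbaum_rel T V `` {p}, lindenbaum_rel T V `` {q}})"
proof -
  interpret partial_order "lindenbaum T V" by (rule partial_order_lindenbaum)
  have c: "Conj p q \<in> forms V" using assms by (simp add: forms_def)
  show ?thesis
  proof (rule greatest_LowerI)
    fix X assume "X \<in> {lindenbaum_rel T V `` {p}, lindenbaum_rel T V `` {q}}"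
    moreover have "insert (Conj p q) T \<turnstile> p" "insert (Conj p q) T \<turnstile> q"
      by (meson Assm ConjE1 ConjE2 insertI1)+
    ultimately show "lindenbaum_rel T V `` {Conj p q} \<sqsubseteq>\<^bsub>lindenbaum T V\<^esub> X"
      using lindenbaum_le[OF c assms(1)] lindenbaum_le[OF c assms(2)] by blast
  next
    fix Y assume Y: "Y \<in> Lower (lindenbaum T V) {lindenbaum_rel T V `` {p}, lindenbaum_rel T V `` {q}}"
    then have "Y \<in> carrier (lindenbaum T V)" unfolding Lower_def by (rule IntD2)
    then obtain r where r: "r \<in> forms V" "Y = lindenbaum_rel T V `` {r}"
      by (rule lindenbaum_carrierE)
    have "Y \<sqsubseteq>\<^bsub>lindenbaum T V\<^esub> lindenbaum_rel T V `` {p}"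
      "Y \<sqsubseteq>\<^bsub>lindenbaum T V\<^esub> lindenbaum_rel T V `` {q}"
      using Y assms[THEN lindenbaum_carrierI] unfolding Lower_def by simp_all
    then have "insert r T \<turnstile> p" "insert r T \<turnstile> q"
      unfolding r(2) lindenbaum_le[OF r(1) assms(1)] lindenbaum_le[OF r(1) assms(2)] .
    then have "insert r T \<turnstile> Conj p q" by (rule ConjI)
    then show "Y \<sqsubseteq>\<^bsub>lindenbaum T V\<^esub> lindenbaum_rel T V `` {Conj p q}"
      unfolding r(2) lindenbaum_le[OF r(1) c] .
  qed (use assms c lindenbaum_carrierI in blast)+
qed

lemma least_lindenbaum:
  assumes "p \<in> forms V" "q \<in> forms V"
  shows "least (lindenbaum T V) (lindenbaum_rel T V `` {Disj p q})
    (Upper (lindenbaum T V) {lindenbaum_rel T V `` {p}, lindenbaum_rel T V `` {q}})"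
proof -
  interpret partial_order "lindenbaum T V" by (rule partial_order_lindenbaum)
  have c: "Disj p q \<in> forms V" using assms by (simp add: forms_def)
  show ?thesis
  proof (rule least_UpperI)
    fix X assume "X \<in> {lindenbaum_rel T V `` {p}, lindenbaum_rel T V `` {q}}"
    moreover have "insert p T \<turnstile> Disj p q" "insert q T \<turnstile> Disj p q"
      by (meson Assm DisjI1 DisjI2 insertI1)+
    ultimately show "X \<sqsubseteq>\<^bsub>lindenbaum T V\<^esub> lindenbaum_rel T V `` {Disj p q}"
      using lindenbaum_le[OF assms(1) c] lindenbaum_le[OF assms(2) c] by blast
  next
    fix Y assume Y: "Y \<in> Upper (lindenbaum T V) {lindenbaum_rel T V `` {p}, lindenbaum_rel T V `` {q}}"
    then have "Y \<in> carrier (lindenbaum T V)" unfolding Upper_def by (rule IntD2)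
    then obtain r where r: "r \<in> forms V" "Y = lindenbaum_rel T V `` {r}"
      by (rule lindenbaum_carrierE)
    have "lindenbaum_rel T V `` {p} \<sqsubseteq>\<^bsub>lindenbaum T V\<^esub> Y"
      "lindenbaum_rel T V `` {q} \<sqsubseteq>\<^bsub>lindenbaum T V\<^esub> Y"
      using Y assms[THEN lindenbaum_carrierI] unfolding Upper_def by simp_all
    then have *: "insert p T \<turnstile> r" "insert q T \<turnstile> r"
      unfolding r(2) lindenbaum_le[OF assms(1) r(1)] lindenbaum_le[OF assms(2) r(1)] .
    have "insert (Disj p q) T \<turnstile> r"
    proof (rule DisjE)
      show "insert (Disj p q) T \<turnstile> Disj p q" by (rule Assm) simp
      show "insert p (insert (Disj p q) T) \<turnstile> r" using *(1) by (rule derives_mono) blast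
      show "insert q (insert (Disj p q) T) \<turnstile> r" using *(2) by (rule derives_mono) blast
    qed
    then show "lindenbaum_rel T V `` {Disj p q} \<sqsubseteq>\<^bsub>lindenbaum T V\<^esub> Y"
      unfolding r(2) lindenbaum_le[OF c r(1)] .
  qed (use assms c lindenbaum_carrierI in blast)+
qed

lemma lattice_lindenbaum: "lattice (lindenbaum T V)"
proof -
  interpret partial_order "lindenbaum T V" by (rule partial_order_lindenbaum)
  show ?thesis
    by unfold_locales
      (metis lindenbaum_carrierE least_lindenbaum, metis lindenbaum_carrierE greatest_lindenbaum)
qed

lemma lindenbaum_meet:
  assumes "p \<in> forms V" "q \<in> forms V"
  shows "lindenbaum_rel T V `` {p} \<sqinter>\<^bsub>lindenbaum T V\<^esub> lindenbaum_rel T V `` {q}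
    = lindenbaum_rel T V `` {Conj p q}"
proof -
  interpret lattice "lindenbaum T V" by (rule lattice_lindenbaum)
  show ?thesis
    by (rule meetI[OF _ assms[THEN lindenbaum_carrierI]])
      (rule greatest_unique[OF _ greatest_lindenbaum[OF assms]])
qed

lemma lindenbaum_join:
  assumes "p \<in> forms V" "q \<in> forms V"
  shows "lindenbaum_rel T V `` {p} \<squnion>\<^bsub>lindenbaum T V\<^esub> lindenbaum_rel T V `` {q}
    = lindenbaum_rel T V `` {Disj p q}"
proof -
  interpret lattice "lindenbaum T V" by (rule lattice_lindenbaum)
  show ?thesis
    by (rule joinI[OF _ assms[THEN lindenbaum_carrierI]])
      (rule least_unique[OF _ least_lindenbaum[OF assms]])
qed

definition lattice_embedding ::
    "('a, 'c) gorder_scheme \<Rightarrow> ('b, 'd) gorder_scheme \<Rightarrow> ('a \<Rightarrow> 'b) \<Rightarrow> bool" where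
  "lattice_embedding L M f \<longleftrightarrow>
     f \<in> carrier L \<rightarrow> carrier M \<and> inj_on f (carrier L) \<and>
     (\<forall>x\<in>carrier L. \<forall>y\<in>carrier L.
        f (x \<sqinter>\<^bsub>L\<^esub> y) = f x \<sqinter>\<^bsub>M\<^esub> f y \<and> f (x \<squnion>\<^bsub>L\<^esub> y) = f x \<squnion>\<^bsub>M\<^esub> f y)"

end

theory Submission
  imports Defs
begin

text \<open>
  The reason is that every element of a free Heyting algebra breaks into finitely many pieces
  that cannot be split further, whereas the top of an infinite Boolean algebra is the join of
  disjoint pairs in infinitely many ways. Call a set of formulas \<^emph>\<open>prime\<close> if whenever it derives a disjunction it derives one of the two disjuncts. Every
  formula \<open>t\<close> is intuitionistically a finite join of prime pieces: a formula that follows from each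
  of finitely many suitable prime sets \<open>\<Delta>\<close> containing \<open>t\<close> follows from \<open>t\<close> already
  (\<open>derives_by_prime_extensions\<close>). If \<open>x\<close> has a complement \<open>y\<close> relative to an interval \<open>[b, t]\<close>,
  each \<open>\<Delta>\<close> derives \<open>x \<or> y\<close>, hence \<open>x\<close> or \<open>y\<close>; and where it derives \<open>y\<close>, the part of \<open>x\<close> in that
  piece is at most \<open>x \<and> y = b\<close>. So \<open>x\<close> is determined, up to equivalence, by the
  finite collection of \<open>\<Delta>\<close> that derive it (\<open>relatively_complemented_le\<close>), and an interval has
  only finitely many complemented elements. A lattice embedding of a Boolean algebra sends every
  element to a complemented element of the interval between the images of bottom and top, so its
  domain would be finite; but distinct variables are classically inequivalent.

  The prime sets are found among the subsets of the finite set \<open>S\<close> of subformulas of \<open>t\<close>. It is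
  easy to split cases until every disjunction \<^emph>\<open>in\<close> \<open>S\<close> that is derived has a derived disjunct.
  That this local condition already yields primeness for all disjunctions, in whatever
  variables, is the crucial point; it follows from the Kleene--Aczel slash
  (\<open>saturated_prime\<close>). Since primeness is not restricted to any set of variables, the argument
  is the same for every set \<open>V\<close> of generators.
\<close>

section \<open>The slash and primeness\<close>

lemma derives_cut_set:
  "\<Gamma> \<turnstile> p \<Longrightarrow> (\<And>x. x \<in> \<Gamma> \<Longrightarrow> \<Delta> \<turnstile> x) \<Longrightarrow> \<Delta> \<turnstile> p"
proof (induction arbitrary: \<Delta> rule: derives.induct)
  case (DisjE \<Gamma> p q r)
  have "insert a \<Delta> \<turnstile> x" if "x \<in> insert a \<Gamma>" for a x
    using that DisjE.prems by (auto intro: Assm derives_mono[OF _ subset_insertI])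
  then show ?case using DisjE by (meson derives.DisjE)
next
  case (ImplI p \<Gamma> q)
  have "insert p \<Delta> \<turnstile> x" if "x \<in> insert p \<Gamma>" for x
    using that ImplI.prems by (auto intro: Assm derives_mono[OF _ subset_insertI])
  then show ?case using ImplI by (meson derives.ImplI)
qed (blast intro: derives.intros)+

text \<open>The Kleene--Aczel slash, usually written \<open>\<Gamma> | p\<close>: a realizability reading of \<open>p\<close> in
  which a disjunction holds only through one of its disjuncts.\<close>

primrec slashes :: "form set \<Rightarrow> form \<Rightarrow> bool" where
  "slashes \<Gamma> (Var x) \<longleftrightarrow> \<Gamma> \<turnstile> Var x"
| "slashes \<Gamma> Falsum \<longleftrightarrow> \<Gamma> \<turnstile> Falsum"
| "slashes \<Gamma> (Conj p q) \<longleftrightarrow> slashes \<Gamma> p \<and> slashes \<Gamma> q"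
| "slashes \<Gamma> (Disj p q) \<longleftrightarrow> slashes \<Gamma> p \<or> slashes \<Gamma> q"
| "slashes \<Gamma> (Impl p q) \<longleftrightarrow> \<Gamma> \<turnstile> Impl p q \<and> (slashes \<Gamma> p \<longrightarrow> slashes \<Gamma> q)"

lemma slashes_imp_derives: "slashes \<Gamma> p \<Longrightarrow> \<Gamma> \<turnstile> p"
  by (induction p) (auto intro: ConjI DisjI1 DisjI2)

lemma slashes_if_inconsistent: "\<Gamma> \<turnstile> Falsum \<Longrightarrow> slashes \<Gamma> p"
  by (induction p) (auto intro: FalsumE)

lemma slashes_sound:
  "\<Gamma> \<turnstile> p \<Longrightarrow> (\<And>x. x \<in> \<Gamma> \<Longrightarrow> slashes \<Delta> x) \<Longrightarrow> slashes \<Delta> p"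
proof (induction rule: derives.induct)
  case (FalsumE \<Gamma> p)
  then show ?case by (simp add: slashes_if_inconsistent)
next
  case (ImplI p \<Gamma> q)
  have "\<Delta> \<turnstile> Impl p q"
    using derives.ImplI[OF ImplI.hyps] ImplI.prems
    by (blast intro: derives_cut_set slashes_imp_derives)
  then show ?case using ImplI by auto
qed auto

primrec subformulas :: "form \<Rightarrow> form set" where
  "subformulas (Var x) = {Var x}"
| "subformulas Falsum = {Falsum}"
| "subformulas (Conj p q) = insert (Conj p q) (subformulas p \<union> subformulas q)"
| "subformulas (Disj p q) = insert (Disj p q) (subformulas p \<union> subformulas q)"
| "subformulas (Impl p q) = insert (Impl p q) (subformulas p \<union> subformulas q)"

lemma finite_subformulas: "finite (subformulas p)"
  by (induction p) auto

lemma subformulas_refl: "p \<in> subformulas p"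
  by (cases p) auto

lemma subformulas_trans: "q \<in> subformulas p \<Longrightarrow> subformulas q \<subseteq> subformulas p"
  by (induction p) auto

definition saturated :: "form set \<Rightarrow> form set \<Rightarrow> bool" where
  "saturated S \<Gamma> \<longleftrightarrow> (\<forall>p q. Disj p q \<in> S \<longrightarrow> \<Gamma> \<turnstile> Disj p q \<longrightarrow> \<Gamma> \<turnstile> p \<or> \<Gamma> \<turnstile> q)"

text \<open>The disjunction clause is the only one in which derivability could fail to give the slash,
  and saturation covers exactly the disjunctions met in the recursion on \<open>p\<close>.\<close>

lemma saturated_derives_imp_slashes:
  assumes "saturated S \<Gamma>" "subformulas p \<subseteq> S" "\<Gamma> \<turnstile> p"
  shows "slashes \<Gamma> p"
  using assms(2,3)
proof (induction p)
  case (Conj p q)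
  then show ?case by (auto intro: ConjE1 ConjE2)
next
  case (Disj p q)
  then show ?case using assms(1) by (auto simp: saturated_def)
next
  case (Impl p q)
  have "slashes \<Gamma> q" if "slashes \<Gamma> p"
    using Impl slashes_imp_derives[OF that] by (auto intro: ImplE)
  then show ?case using Impl.prems by simp
qed auto

text \<open>A saturated set of subformulas slashes each of its own members, so by soundness it slashes
  everything it derives; the slash of a disjunction then selects a disjunct, whether or not
  the disjunction is among the subformulas.\<close>

lemma saturated_prime:
  assumes "saturated (subformulas t) \<Gamma>" "\<Gamma> \<subseteq> subformulas t" "\<Gamma> \<turnstile> Disj p q"
  shows "\<Gamma> \<turnstile> p \<or> \<Gamma> \<turnstile> q"
proof -
  have "slashes \<Gamma> x" if "x \<in> \<Gamma>" for x
    using that assms(1,2) subformulas_trans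
    by (blast intro: saturated_derives_imp_slashes Assm)
  then have "slashes \<Gamma> (Disj p q)" by (rule slashes_sound[OF assms(3)])
  then show ?thesis by (auto intro: slashes_imp_derives)
qed

section \<open>Decomposition into prime pieces\<close>

text \<open>A failure of saturation at \<open>p \<or> q\<close> allows a case split that
  enlarges \<open>\<Gamma>\<close> strictly in both branches; as \<open>S\<close> is finite, the splitting stops.\<close>

lemma derives_by_saturated_extensions:
  assumes "finite S" "\<And>p q. Disj p q \<in> S \<Longrightarrow> p \<in> S \<and> q \<in> S" "\<Gamma> \<subseteq> S"
    and "\<And>\<Delta>. \<Gamma> \<subseteq> \<Delta> \<Longrightarrow> \<Delta> \<subseteq> S \<Longrightarrow> saturated S \<Delta> \<Longrightarrow> \<Delta> \<turnstile> r"
  shows "\<Gamma> \<turnstile> r"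
  using assms(3,4)
proof (induction "card (S - \<Gamma>)" arbitrary: \<Gamma> rule: less_induct)
  case less
  show ?case
  proof (cases "saturated S \<Gamma>")
    case True
    then show ?thesis using less.prems by blast
  next
    case False
    then obtain p q where pq: "Disj p q \<in> S" "\<Gamma> \<turnstile> Disj p q" "\<not> \<Gamma> \<turnstile> p" "\<not> \<Gamma> \<turnstile> q"
      by (auto simp: saturated_def)
    have "insert a \<Gamma> \<turnstile> r" if a: "a \<in> S" "\<not> \<Gamma> \<turnstile> a" for a
    proof (rule less.hyps)
      have "a \<notin> \<Gamma>" using a(2) Assm by blast
      then show "card (S - insert a \<Gamma>) < card (S - \<Gamma>)"
        using a(1) assms(1) by (intro psubset_card_mono) auto
    qed (use a less.prems in auto)
    then show ?thesis using pq assms(2) by (blast intro: DisjE)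
  qed
qed

definition prime_extensions :: "form \<Rightarrow> form set set" where
  "prime_extensions t =
     {\<Delta>. t \<in> \<Delta> \<and> \<Delta> \<subseteq> subformulas t \<and> saturated (subformulas t) \<Delta>}"

lemma finite_prime_extensions: "finite (prime_extensions t)"
  by (rule finite_subset[of _ "Pow (subformulas t)"])
    (auto simp: prime_extensions_def finite_subformulas)

lemma derives_by_prime_extensions:
  assumes "\<And>\<Delta>. \<Delta> \<in> prime_extensions t \<Longrightarrow> \<Delta> \<turnstile> r"
  shows "{t} \<turnstile> r"
proof (rule derives_by_saturated_extensions)
  show "p \<in> subformulas t \<and> q \<in> subformulas t" if "Disj p q \<in> subformulas t" for p q
    using subformulas_trans[OF that] subformulas_refl by auto
qed (use assms in \<open>auto simp: prime_extensions_def finite_subformulas subformulas_refl\<close>)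

text \<open>Consider the piece of \<open>x\<close> inside some \<open>\<Delta>\<close>. If \<open>\<Delta>\<close> derives \<open>x\<close>, then it derives \<open>z\<close> by
  hypothesis. Otherwise primeness makes it derive the complement \<open>y\<close>, and there \<open>x\<close> collapses to
  \<open>b\<close>, which is below \<open>z\<close>.\<close>

lemma relatively_complemented_le:
  assumes "{x} \<turnstile> t" "{t} \<turnstile> Disj x y" "{Conj x y} \<turnstile> b" "{b} \<turnstile> z"
    and le: "\<And>\<Delta>. \<Delta> \<in> prime_extensions t \<Longrightarrow> \<Delta> \<turnstile> x \<Longrightarrow> \<Delta> \<turnstile> z"
  shows "{x} \<turnstile> z"
proof -
  have "{t} \<turnstile> Impl x z"
  proof (rule derives_by_prime_extensions)
    fix \<Delta> assume \<Delta>: "\<Delta> \<in> prime_extensions t"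
    then have "\<Delta> \<turnstile> Disj x y"
      using derives_mono[OF assms(2)] by (simp add: prime_extensions_def)
    then have "\<Delta> \<turnstile> x \<or> \<Delta> \<turnstile> y"
      using \<Delta> by (intro saturated_prime) (auto simp: prime_extensions_def)
    then show "\<Delta> \<turnstile> Impl x z"
    proof
      assume "\<Delta> \<turnstile> x"
      then show ?thesis by (blast intro: ImplI derives_mono le[OF \<Delta>])
    next
      assume "\<Delta> \<turnstile> y"
      then have "insert x \<Delta> \<turnstile> Conj x y" by (blast intro: ConjI Assm derives_mono)
      then have "insert x \<Delta> \<turnstile> b" by (auto intro: derives_cut_set[OF assms(3)])
      then have "insert x \<Delta> \<turnstile> z" by (auto intro: derives_cut_set[OF assms(4)])
      then show ?thesis by (rule ImplI)
    qed
  qed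
  then have "{x} \<turnstile> Impl x z" using assms(1) derives_cut by blast
  then show ?thesis by (rule ImplE) (simp add: Assm)
qed

section \<open>Classical inequivalence of variables\<close>

primrec truth :: "(nat \<Rightarrow> bool) \<Rightarrow> form \<Rightarrow> bool" where
  "truth v (Var x) \<longleftrightarrow> v x"
| "truth v Falsum \<longleftrightarrow> False"
| "truth v (Conj p q) \<longleftrightarrow> truth v p \<and> truth v q"
| "truth v (Disj p q) \<longleftrightarrow> truth v p \<or> truth v q"
| "truth v (Impl p q) \<longleftrightarrow> (truth v p \<longrightarrow> truth v q)"

lemma truth_sound: "\<Gamma> \<turnstile> p \<Longrightarrow> (\<And>x. x \<in> \<Gamma> \<Longrightarrow> truth v x) \<Longrightarrow> truth v p"
  by (induction rule: derives.induct) auto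

lemma classical_Var_derives_Var_iff: "insert (Var i) excluded_middle \<turnstile> Var j \<longleftrightarrow> i = j"
proof
  assume "insert (Var i) excluded_middle \<turnstile> Var j"
  then have "truth (\<lambda>k. k = i) (Var j)"
    by (rule truth_sound) (auto simp: excluded_middle_def)
  then show "i = j" by simp
qed (simp add: Assm)

section \<open>Embeddings into free Heyting algebras\<close>

text \<open>Choosing a formula in the image of each class turns a lattice embedding into a
  translation of formulas, so that the rest can be argued with derivations alone.\<close>

lemma lattice_embedding_representatives:
  assumes f: "lattice_embedding (lindenbaum T UNIV) (lindenbaum T' V) f"
  obtains g where
    "\<And>p q. insert (g p) T' \<turnstile> g q \<and> insert (g q) T' \<turnstile> g p \<longleftrightarrow>
       insert p T \<turnstile> q \<and> insert q T \<turnstile> p"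
    "\<And>p q. insert (g (Conj p q)) T' \<turnstile> Conj (g p) (g q)"
    "\<And>p q. insert (Conj (g p) (g q)) T' \<turnstile> g (Conj p q)"
    "\<And>p q. insert (g (Disj p q)) T' \<turnstile> Disj (g p) (g q)"
    "\<And>p q. insert (Disj (g p) (g q)) T' \<turnstile> g (Disj p q)"
proof -
  let ?c = "\<lambda>p. lindenbaum_rel T UNIV `` {p}"
  let ?d = "\<lambda>p. lindenbaum_rel T' V `` {p}"
  have U: "p \<in> forms UNIV" for p by (simp add: forms_def)
  have c: "?c p \<in> carrier (lindenbaum T UNIV)" for p by (rule lindenbaum_carrierI[OF U])
  have fc: "f (?c p) \<in> carrier (lindenbaum T' V)" for p
    using f c by (auto simp: lattice_embedding_def)
  have "\<exists>q. q \<in> forms V \<and> f (?c p) = ?d q" for p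
    using fc by (rule lindenbaum_carrierE) blast
  then obtain g where g: "\<And>p. g p \<in> forms V" "\<And>p. f (?c p) = ?d (g p)" by metis
  have inj: "?d (g p) = ?d (g q) \<longleftrightarrow> ?c p = ?c q" for p q
    using f c unfolding lattice_embedding_def g(2)[symmetric] by (metis inj_onD)
  have Vcl: "Conj (g p) (g q) \<in> forms V" "Disj (g p) (g q) \<in> forms V" for p q
    using g(1)[of p] g(1)[of q] by (simp_all add: forms_def)
  have "?d (g (Conj p q)) = ?d (Conj (g p) (g q))" for p q
    using f c lindenbaum_meet[OF U U, of T p q] lindenbaum_meet[OF g(1) g(1), of T' p q]
    unfolding lattice_embedding_def g(2)[symmetric] by metis
  moreover have "?d (g (Disj p q)) = ?d (Disj (g p) (g q))" for p q
    using f c lindenbaum_join[OF U U, of T p q] lindenbaum_join[OF g(1) g(1), of T' p q]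
    unfolding lattice_embedding_def g(2)[symmetric] by metis
  ultimately show thesis
    using that[of g] inj
    unfolding lindenbaum_class_eq_iff[OF U U] lindenbaum_class_eq_iff[OF g(1) g(1)]
      lindenbaum_class_eq_iff[OF g(1) Vcl(1)] lindenbaum_class_eq_iff[OF g(1) Vcl(2)]
    by blast
qed

lemma no_lattice_embedding_B_omega:
  "\<not> lattice_embedding B_omega (lindenbaum {} V) f"
proof
  assume "lattice_embedding B_omega (lindenbaum {} V) f"
  then obtain g where
    eq: "\<And>p q. {g p} \<turnstile> g q \<and> {g q} \<turnstile> g p \<longleftrightarrow>
       insert p excluded_middle \<turnstile> q \<and> insert q excluded_middle \<turnstile> p"
    and gConj: "\<And>p q. {Conj (g p) (g q)} \<turnstile> g (Conj p q)"
      "\<And>p q. {g (Conj p q)} \<turnstile> Conj (g p) (g q)"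
    and gDisj: "\<And>p q. {Disj (g p) (g q)} \<turnstile> g (Disj p q)"
      "\<And>p q. {g (Disj p q)} \<turnstile> Disj (g p) (g q)"
    unfolding B_omega_def by (rule lattice_embedding_representatives) blast
  let ?t = "g (Neg Falsum)" and ?b = "g Falsum"
  have top: "{g (Disj p (Neg p))} \<turnstile> ?t \<and> {?t} \<turnstile> g (Disj p (Neg p))" for p
    unfolding eq by (auto simp: excluded_middle_def intro: Assm ImplI)
  have bot: "{g (Conj p (Neg p))} \<turnstile> ?b \<and> {?b} \<turnstile> g (Conj p (Neg p))" for p
    unfolding eq by (meson Assm FalsumE ConjE1 ConjE2 ImplE insertI1)
  have below_top: "{g p} \<turnstile> ?t" for p
  proof -
    have "{g p} \<turnstile> Disj (g p) (g (Neg p))" by (simp add: DisjI1 Assm)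
    then show ?thesis using gDisj(1) top derives_cut by blast
  qed
  have above_bot: "{?b} \<turnstile> g p" for p
    using gConj(2) bot[of p] derives_cut ConjE1 by blast
  have top_Disj: "{?t} \<turnstile> Disj (g p) (g (Neg p))" for p
    using gDisj(2) top derives_cut by blast
  have Conj_bot: "{Conj (g p) (g (Neg p))} \<turnstile> ?b" for p
    using gConj(1) bot derives_cut by blast
  define h where "h p = {\<Delta> \<in> prime_extensions ?t. \<Delta> \<turnstile> g p}" for p
  have le: "{g p} \<turnstile> g q" if "h p = h q" for p q
    by (rule relatively_complemented_le[OF below_top top_Disj Conj_bot above_bot])
      (use that in \<open>auto simp: h_def\<close>)
  have "range (\<lambda>i. h (Var i)) \<subseteq> Pow (prime_extensions ?t)" by (auto simp: h_def)
  then have "finite (range (\<lambda>i. h (Var i)))"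
    using finite_prime_extensions finite_subset by blast
  then have "\<not> inj (\<lambda>i. h (Var i))" using finite_imageD infinite_UNIV_nat by blast
  then obtain i j where "i \<noteq> j" "h (Var i) = h (Var j)" by (auto simp: inj_def)
  then have "insert (Var i) excluded_middle \<turnstile> Var j"
    using le eq[of "Var i" "Var j"] by metis
  then show False using \<open>i \<noteq> j\<close> by (simp add: classical_Var_derives_Var_iff)
qed

theorem proposition16:
  shows "(\<forall>n. \<not> (\<exists>f. lattice_embedding B_omega (H_fin n) f)) \<and>
         \<not> (\<exists>f. lattice_embedding B_omega H_omega f)"
  by (simp add: H_fin_def H_omega_def no_lattice_embedding_B_omega)

end
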